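(* Let $\mathbb{L}$ be a regular pseudocomplemented Kleene algebra satisfying $x^*\vee x^{**}=1$ for all $x$. Then there exist a set $U$ and an equivalence relation $E$ on $U$ such that $\mathbb{L}$ is isomorphic to a subalgebra of the pseudocomplemented Kleene algebra $(\mathit{RS},\vee,\wedge,{\sim},{^*},(\emptyset,\emptyset),(U,U))$ defined by $E$.
   Context: A pseudocomplemented Kleene algebra is an algebra $(L,\vee,\wedge,{\sim},{^*},0,1)$ such that $(L,\vee,\wedge,0,1)$ is a bounded distributive lattice, ${\sim}{\sim}x=x$, $x\leq y\Rightarrow{\sim}x\geq{\sim}y$, $x\wedge{\sim}x\leq y\vee{\sim}y$, and ${^*}$ is the pseudocomplement ($x\wedge z=0$ iff $z\leq x^*$); it is regular if $x^*=y^*$ and $({\sim}x)^*=({\sim}y)^*$ imply $x=y$. For an equivalence $E$ on $U$ with classes $[x]_E$, and $X\subseteq U$, let $X^\blacktriangledown=\{x\mid [x]_E\subseteq X\}$, $X^\blacktriangle=\{x\mid [x]_E\cap X\neq\emptyset\}$, $X^c=U\setminus X$. Then $\mathit{RS}=\{(X^\blacktriangledown,X^\blacktriangle)\mid X\subseteq U\}$, ordered componentwise by inclusion, is a lattice with componentwise union and intersection as join and meet; ${\sim}(X^\blacktriangledown,X^\blacktriangle)=(X^{c\blacktriangledown},X^{c\blacktriangle})$ and ${^*}$ is the pseudocomplement in this lattice, given by $(X^\blacktriangledown,X^\blacktriangle)^*=(X^{c\blacktriangledown},X^{c\blacktriangledown})$. *)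

theory Defs
  imports "HOL-Algebra.Congruence"
begin

record 'a pk_algebra = "'a partial_object" +
  pjoin :: "'a \<Rightarrow> 'a \<Rightarrow> 'a" (infixl "\<squnion>\<index>" 65)
  pmeet :: "'a \<Rightarrow> 'a \<Rightarrow> 'a" (infixl "\<sqinter>\<index>" 70)
  pneg :: "'a \<Rightarrow> 'a" ("\<sim>\<index> _" [81] 80)
  pstar :: "'a \<Rightarrow> 'a" ("_\<star>\<index>" [1000] 999)
  pbot :: 'a ("\<zero>\<index>")
  ptop :: 'a ("\<one>\<index>")

definition ple :: "('a, 'm) pk_algebra_scheme \<Rightarrow> 'a \<Rightarrow> 'a \<Rightarrow> bool" (infix "\<sqsubseteq>\<index>" 50)
  where "x \<sqsubseteq>\<^bsub>L\<^esub> y \<longleftrightarrow> x \<sqinter>\<^bsub>L\<^esub> y = x"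

locale bounded_distributive_lattice =
  fixes L (structure)
  assumes join_closed: "\<lbrakk>x \<in> carrier L; y \<in> carrier L\<rbrakk> \<Longrightarrow> x \<squnion> y \<in> carrier L"
    and meet_closed: "\<lbrakk>x \<in> carrier L; y \<in> carrier L\<rbrakk> \<Longrightarrow> x \<sqinter> y \<in> carrier L"
    and bot_closed: "\<zero> \<in> carrier L"
    and top_closed: "\<one> \<in> carrier L"
    and join_comm: "\<lbrakk>x \<in> carrier L; y \<in> carrier L\<rbrakk> \<Longrightarrow> x \<squnion> y = y \<squnion> x"
    and meet_comm: "\<lbrakk>x \<in> carrier L; y \<in> carrier L\<rbrakk> \<Longrightarrow> x \<sqinter> y = y \<sqinter> x"
    and join_assoc: "\<lbrakk>x \<in> carrier L; y \<in> carrier L; z \<in> carrier L\<rbrakk>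
      \<Longrightarrow> (x \<squnion> y) \<squnion> z = x \<squnion> (y \<squnion> z)"
    and meet_assoc: "\<lbrakk>x \<in> carrier L; y \<in> carrier L; z \<in> carrier L\<rbrakk>
      \<Longrightarrow> (x \<sqinter> y) \<sqinter> z = x \<sqinter> (y \<sqinter> z)"
    and join_absorb: "\<lbrakk>x \<in> carrier L; y \<in> carrier L\<rbrakk> \<Longrightarrow> x \<squnion> (x \<sqinter> y) = x"
    and meet_absorb: "\<lbrakk>x \<in> carrier L; y \<in> carrier L\<rbrakk> \<Longrightarrow> x \<sqinter> (x \<squnion> y) = x"
    and meet_join_distrib: "\<lbrakk>x \<in> carrier L; y \<in> carrier L; z \<in> carrier L\<rbrakk>
      \<Longrightarrow> x \<sqinter> (y \<squnion> z) = (x \<sqinter> y) \<squnion> (x \<sqinter> z)"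
    and bot_least: "x \<in> carrier L \<Longrightarrow> \<zero> \<sqsubseteq> x"
    and top_greatest: "x \<in> carrier L \<Longrightarrow> x \<sqsubseteq> \<one>"

locale pseudocomplemented_Kleene_algebra = bounded_distributive_lattice +
  assumes neg_closed: "x \<in> carrier L \<Longrightarrow> \<sim> x \<in> carrier L"
    and star_closed: "x \<in> carrier L \<Longrightarrow> x\<star> \<in> carrier L"
    and neg_neg: "x \<in> carrier L \<Longrightarrow> \<sim> (\<sim> x) = x"
    and neg_antimono: "\<lbrakk>x \<in> carrier L; y \<in> carrier L; x \<sqsubseteq> y\<rbrakk> \<Longrightarrow> \<sim> y \<sqsubseteq> \<sim> x"
    and Kleene: "\<lbrakk>x \<in> carrier L; y \<in> carrier L\<rbrakk> \<Longrightarrow> x \<sqinter> \<sim> x \<sqsubseteq> y \<squnion> \<sim> y"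
    and pseudocomplement: "\<lbrakk>x \<in> carrier L; z \<in> carrier L\<rbrakk> \<Longrightarrow> x \<sqinter> z = \<zero> \<longleftrightarrow> z \<sqsubseteq> x\<star>"

locale regular_pseudocomplemented_Kleene_algebra = pseudocomplemented_Kleene_algebra +
  assumes regular: "\<lbrakk>x \<in> carrier L; y \<in> carrier L; x\<star> = y\<star>; (\<sim> x)\<star> = (\<sim> y)\<star>\<rbrakk> \<Longrightarrow> x = y"

definition pk_subalgebra :: "'a set \<Rightarrow> ('a, 'm) pk_algebra_scheme \<Rightarrow> bool"
  where "pk_subalgebra S L \<longleftrightarrow>
    S \<subseteq> carrier L \<and> \<zero>\<^bsub>L\<^esub> \<in> S \<and> \<one>\<^bsub>L\<^esub> \<in> S \<and>
    (\<forall>x\<in>S. \<forall>y\<in>S. x \<squnion>\<^bsub>L\<^esub> y \<in> S \<and> x \<sqinter>\<^bsub>L\<^esub> y \<in> S) \<and>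
    (\<forall>x\<in>S. \<sim>\<^bsub>L\<^esub> x \<in> S \<and> x\<star>\<^bsub>L\<^esub> \<in> S)"

definition pk_iso :: "('a, 'm) pk_algebra_scheme \<Rightarrow> ('b, 'n) pk_algebra_scheme \<Rightarrow> ('a \<Rightarrow> 'b) set"
  where "pk_iso L M = {h. bij_betw h (carrier L) (carrier M) \<and>
    h \<zero>\<^bsub>L\<^esub> = \<zero>\<^bsub>M\<^esub> \<and> h \<one>\<^bsub>L\<^esub> = \<one>\<^bsub>M\<^esub> \<and>
    (\<forall>x\<in>carrier L. \<forall>y\<in>carrier L.
      h (x \<squnion>\<^bsub>L\<^esub> y) = h x \<squnion>\<^bsub>M\<^esub> h y \<and> h (x \<sqinter>\<^bsub>L\<^esub> y) = h x \<sqinter>\<^bsub>M\<^esub> h y) \<and>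
    (\<forall>x\<in>carrier L. h (\<sim>\<^bsub>L\<^esub> x) = \<sim>\<^bsub>M\<^esub> h x \<and> h (x\<star>\<^bsub>L\<^esub>) = (h x)\<star>\<^bsub>M\<^esub>)}"

definition pk_isomorphic :: "('a, 'm) pk_algebra_scheme \<Rightarrow> ('b, 'n) pk_algebra_scheme \<Rightarrow> bool"
  where "pk_isomorphic L M \<longleftrightarrow> pk_iso L M \<noteq> {}"

definition lower_approx :: "'u set \<Rightarrow> ('u \<times> 'u) set \<Rightarrow> 'u set \<Rightarrow> 'u set"
  where "lower_approx U E X = {x \<in> U. E `` {x} \<subseteq> X}"

definition upper_approx :: "'u set \<Rightarrow> ('u \<times> 'u) set \<Rightarrow> 'u set \<Rightarrow> 'u set"
  where "upper_approx U E X = {x \<in> U. E `` {x} \<inter> X \<noteq> {}}"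

definition rough :: "'u set \<Rightarrow> ('u \<times> 'u) set \<Rightarrow> 'u set \<Rightarrow> 'u set \<times> 'u set"
  where "rough U E X = (lower_approx U E X, upper_approx U E X)"

definition RS :: "'u set \<Rightarrow> ('u \<times> 'u) set \<Rightarrow> ('u set \<times> 'u set) set"
  where "RS U E = {rough U E X | X. X \<subseteq> U}"

(* The two unary operations are specified on representatives; independence of the
   representative is rs_neg_rough and rs_star_rough below. *)
definition rs_neg :: "'u set \<Rightarrow> ('u \<times> 'u) set \<Rightarrow> 'u set \<times> 'u set \<Rightarrow> 'u set \<times> 'u set"
  where "rs_neg U E p = (THE q. \<exists>X\<subseteq>U. p = rough U E X \<and> q = rough U E (U - X))"

definition rs_star :: "'u set \<Rightarrow> ('u \<times> 'u) set \<Rightarrow> 'u set \<times> 'u set \<Rightarrow> 'u set \<times> 'u set"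
  where "rs_star U E p = (THE q. \<exists>X\<subseteq>U. p = rough U E X \<and>
    q = (lower_approx U E (U - X), lower_approx U E (U - X)))"

definition RS_algebra :: "'u set \<Rightarrow> ('u \<times> 'u) set \<Rightarrow> ('u set \<times> 'u set) pk_algebra"
  where "RS_algebra U E = \<lparr>carrier = RS U E,
    pjoin = (\<lambda>p q. (fst p \<union> fst q, snd p \<union> snd q)),
    pmeet = (\<lambda>p q. (fst p \<inter> fst q, snd p \<inter> snd q)),
    pneg = rs_neg U E,
    pstar = rs_star U E,
    pbot = ({}, {}),
    ptop = (U, U)\<rparr>"

lemma approx_compl:
  assumes "equiv U E"
  shows "lower_approx U E (U - X) = U - upper_approx U E X"
    and "upper_approx U E (U - X) = U - lower_approx U E X"
  using equiv_type[OF assms] unfolding lower_approx_def upper_approx_def by blast+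

lemma rs_neg_rough:
  assumes "equiv U E" "X \<subseteq> U"
  shows "rs_neg U E (rough U E X) = rough U E (U - X)"
  unfolding rs_neg_def using assms(2)
  by (intro the_equality) (auto simp: rough_def approx_compl[OF assms(1)])

lemma rs_star_rough:
  assumes "equiv U E" "X \<subseteq> U"
  shows "rs_star U E (rough U E X) = (lower_approx U E (U - X), lower_approx U E (U - X))"
  unfolding rs_star_def using assms(2)
  by (intro the_equality) (auto simp: rough_def approx_compl[OF assms(1)])

lemma lower_subset_upper:
  assumes "equiv U E"
  shows "lower_approx U E X \<subseteq> upper_approx U E X"
  using equiv_class_self[OF assms] unfolding lower_approx_def upper_approx_def by blast

lemma rough_join:
  assumes E: "equiv U E" and X: "X \<subseteq> U" and Y: "Y \<subseteq> U"
  obtains Z where "Z \<subseteq> U"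
    "lower_approx U E Z = lower_approx U E X \<union> lower_approx U E Y"
    "upper_approx U E Z = upper_approx U E X \<union> upper_approx U E Y"
proof -
  define A where "A = lower_approx U E X \<union> lower_approx U E Y"
  define B where "B = upper_approx U E X \<union> upper_approx U E Y"
  define f where "f x = (SOME y. y \<in> E `` {x})" for x
  define Z where "Z = A \<union> {x \<in> B. f x = x}"
  have cls: "E `` {y} = E `` {x}" if "(x, y) \<in> E" for x y
    using equiv_class_eq[OF E that] by simp
  have self: "(x, x) \<in> E" if "x \<in> U" for x
    using equiv_class_self[OF E that] by simp
  have sub: "x \<in> U \<and> y \<in> U" if "(x, y) \<in> E" for x y
    using equiv_type[OF E] that by blast
  have f: "(x, f x) \<in> E" if "x \<in> U" for x
    using someI[of "\<lambda>y. y \<in> E `` {x}" x] self[OF that] by (simp add: f_def)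
  have fcls: "f x = f y" if "(x, y) \<in> E" for x y
    using cls[OF that] by (simp add: f_def)
  have satA: "y \<in> A" if "(x, y) \<in> E" "x \<in> A" for x y
    using that cls[OF that(1)] sub[OF that(1)] by (auto simp: A_def lower_approx_def)
  have satB: "y \<in> B" if "(x, y) \<in> E" "x \<in> B" for x y
    using that cls[OF that(1)] sub[OF that(1)] by (auto simp: B_def upper_approx_def)
  have AB: "A \<subseteq> B" and BU: "B \<subseteq> U"
    using lower_subset_upper[OF E] by (auto simp: A_def B_def upper_approx_def)
  have ZB: "Z \<subseteq> B" using AB by (auto simp: Z_def)
  have "lower_approx U E Z \<subseteq> A"
  proof
    fix x assume "x \<in> lower_approx U E Z"
    then have x: "x \<in> U" "E `` {x} \<subseteq> Z" by (auto simp: lower_approx_def)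
    show "x \<in> A"
    proof (rule ccontr)
      assume nA: "x \<notin> A"
      have fix_all: "f y = y \<and> y \<in> B" if "(x, y) \<in> E" for y
      proof -
        have "y \<notin> A" using nA satA[of y x] that E by (meson equivE symD)
        then show ?thesis using x that by (auto simp: Z_def)
      qed
      have one: "y = x" if "(x, y) \<in> E" for y
        using fix_all[OF that] fix_all[OF self[OF x(1)]] fcls[OF that] by simp
      then have cx: "E `` {x} = {x}" using self[OF x(1)] by blast
      have "x \<in> B" using fix_all[OF self[OF x(1)]] by simp
      then have "x \<in> A" using cx x(1) by (auto simp: A_def B_def lower_approx_def upper_approx_def)
      with nA show False by simp
    qed
  qed
  moreover have "A \<subseteq> lower_approx U E Z"
    using satA AB BU by (auto simp: lower_approx_def Z_def)
  moreover have "upper_approx U E Z \<subseteq> B"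
  proof
    fix x assume "x \<in> upper_approx U E Z"
    then obtain y where "(x, y) \<in> E" "y \<in> B" using ZB by (auto simp: upper_approx_def)
    then show "x \<in> B" using satB[of y x] E by (meson equivE symD)
  qed
  moreover have "B \<subseteq> upper_approx U E Z"
  proof
    fix x assume x: "x \<in> B"
    then have xU: "x \<in> U" using BU by auto
    have "f (f x) = f x" using fcls[OF f[OF xU]] by simp
    then have "f x \<in> Z" using satB[OF f[OF xU] x] by (simp add: Z_def)
    then show "x \<in> upper_approx U E Z" using f[OF xU] xU by (auto simp: upper_approx_def)
  qed
  ultimately show thesis
    using that[of Z] ZB BU unfolding A_def B_def by blast
qed

lemma rough_meet:
  assumes E: "equiv U E" and X: "X \<subseteq> U" and Y: "Y \<subseteq> U"
  obtains Z where "Z \<subseteq> U"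
    "lower_approx U E Z = lower_approx U E X \<inter> lower_approx U E Y"
    "upper_approx U E Z = upper_approx U E X \<inter> upper_approx U E Y"
proof -
  obtain W where W: "W \<subseteq> U"
    "lower_approx U E W = lower_approx U E (U - X) \<union> lower_approx U E (U - Y)"
    "upper_approx U E W = upper_approx U E (U - X) \<union> upper_approx U E (U - Y)"
    by (rule rough_join[OF E Diff_subset Diff_subset])
  have "lower_approx U E V \<subseteq> U" "upper_approx U E V \<subseteq> U" for V
    by (auto simp: lower_approx_def upper_approx_def)
  then have "lower_approx U E (U - W) = lower_approx U E X \<inter> lower_approx U E Y"
    "upper_approx U E (U - W) = upper_approx U E X \<inter> upper_approx U E Y"
    unfolding approx_compl[OF E] W(2,3) by blast+
  then show thesis
    by (rule that[OF Diff_subset])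
qed

theorem RS_pseudocomplemented_Kleene_algebra:
  assumes E: "equiv U E"
  shows "pseudocomplemented_Kleene_algebra (RS_algebra U E)"
proof -
  have LU: "lower_approx U E V \<subseteq> U" "upper_approx U E V \<subseteq> U" for V
    by (auto simp: lower_approx_def upper_approx_def)
  have join: "(fst p \<union> fst q, snd p \<union> snd q) \<in> RS U E" if pq: "p \<in> RS U E" "q \<in> RS U E" for p q
  proof -
    obtain X Y where XY: "X \<subseteq> U" "p = rough U E X" "Y \<subseteq> U" "q = rough U E Y"
      using pq by (auto simp: RS_def)
    obtain Z where "Z \<subseteq> U"
      "lower_approx U E Z = lower_approx U E X \<union> lower_approx U E Y"
      "upper_approx U E Z = upper_approx U E X \<union> upper_approx U E Y"
      by (rule rough_join[OF E XY(1,3)])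
    then have "Z \<subseteq> U" "rough U E Z = (fst p \<union> fst q, snd p \<union> snd q)"
      by (simp_all add: XY(2,4) rough_def)
    then show ?thesis unfolding RS_def by (metis (mono_tags, lifting) mem_Collect_eq)
  qed
  have meet: "(fst p \<inter> fst q, snd p \<inter> snd q) \<in> RS U E" if pq: "p \<in> RS U E" "q \<in> RS U E" for p q
  proof -
    obtain X Y where XY: "X \<subseteq> U" "p = rough U E X" "Y \<subseteq> U" "q = rough U E Y"
      using pq by (auto simp: RS_def)
    obtain Z where "Z \<subseteq> U"
      "lower_approx U E Z = lower_approx U E X \<inter> lower_approx U E Y"
      "upper_approx U E Z = upper_approx U E X \<inter> upper_approx U E Y"
      by (rule rough_meet[OF E XY(1,3)])
    then have "Z \<subseteq> U" "rough U E Z = (fst p \<inter> fst q, snd p \<inter> snd q)"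
      by (simp_all add: XY(2,4) rough_def)
    then show ?thesis unfolding RS_def by (metis (mono_tags, lifting) mem_Collect_eq)
  qed
  have neg: "rs_neg U E p = (U - snd p, U - fst p)" if "p \<in> RS U E" for p
    using that by (auto simp: RS_def rs_neg_rough[OF E]) (auto simp: rough_def approx_compl[OF E])
  have star: "rs_star U E p = (U - snd p, U - snd p)" if "p \<in> RS U E" for p
    using that by (auto simp: RS_def rs_star_rough[OF E]) (auto simp: rough_def approx_compl[OF E])
  have range: "fst p \<subseteq> snd p" "snd p \<subseteq> U" if "p \<in> RS U E" for p
    using that by (auto simp: RS_def rough_def dest!: subsetD[OF lower_subset_upper[OF E]] subsetD[OF LU(2)])
  have neg_in: "rs_neg U E p \<in> RS U E" if "p \<in> RS U E" for p
    using that by (auto simp: RS_def rs_neg_rough[OF E])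
  have idem: "lower_approx U E (U - upper_approx U E X) = U - upper_approx U E X"
    "upper_approx U E (U - upper_approx U E X) = U - upper_approx U E X" for X
  proof -
    have "E `` {y} = E `` {x}" if "(x, y) \<in> E" for x y
      using equiv_class_eq[OF E that] by simp
    then show "lower_approx U E (U - upper_approx U E X) = U - upper_approx U E X"
      "upper_approx U E (U - upper_approx U E X) = U - upper_approx U E X"
      using equiv_class_self[OF E] equiv_type[OF E]
      unfolding lower_approx_def upper_approx_def by (blast, blast)
  qed
  have star_in: "rs_star U E p \<in> RS U E" if p: "p \<in> RS U E" for p
  proof -
    obtain X where X: "X \<subseteq> U" "p = rough U E X" using p by (auto simp: RS_def)
    have "rs_star U E p = rough U E (U - upper_approx U E X)"
      unfolding star[OF p] using X(2) by (simp add: rough_def idem)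
    then show ?thesis unfolding RS_def by blast
  qed
  have bot: "({}, {}) \<in> RS U E"
  proof -
    have "rough U E {} = ({}, {})"
      using equiv_class_self[OF E] by (auto simp: rough_def lower_approx_def upper_approx_def)
    then show ?thesis unfolding RS_def by (metis (mono_tags, lifting) empty_subsetI mem_Collect_eq)
  qed
  have top: "(U, U) \<in> RS U E"
    using neg_in[OF bot] neg[OF bot] by simp
  show ?thesis
  proof (unfold_locales, simp_all add: RS_algebra_def ple_def join meet bot top neg_in star_in)
    fix p assume p: "p \<in> RS U E"
    show "(fst p \<inter> U, snd p \<inter> U) = p" using range[OF p] by (auto intro!: prod_eqI)
    show "rs_neg U E (rs_neg U E p) = p"
      using range[OF p] neg[OF neg_in[OF p]] neg[OF p] by (auto intro!: prod_eqI)
    fix q assume q: "q \<in> RS U E"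
    show "fst p \<inter> fst (rs_neg U E p) \<inter> (fst q \<union> fst (rs_neg U E q)) = fst p \<inter> fst (rs_neg U E p) \<and>
      snd p \<inter> snd (rs_neg U E p) \<inter> (snd q \<union> snd (rs_neg U E q)) = snd p \<inter> snd (rs_neg U E p)"
      using range[OF p] range[OF q] by (auto simp: neg p q)
    show "(fst p \<inter> fst q = {} \<and> snd p \<inter> snd q = {}) =
      ((fst q \<inter> fst (rs_star U E p), snd q \<inter> snd (rs_star U E p)) = q)"
      unfolding star[OF p] using range[OF p] range[OF q] by (cases p; cases q) auto
    assume "(fst p \<inter> fst q, snd p \<inter> snd q) = p"
    then show "(fst (rs_neg U E q) \<inter> fst (rs_neg U E p), snd (rs_neg U E q) \<inter> snd (rs_neg U E p)) =
      rs_neg U E q"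
      unfolding neg[OF p] neg[OF q] by (cases p; cases q) auto
  qed auto
qed

end

theory Submission
  imports Defs
begin

text \<open>
  Points of \<open>U\<close> are the prime filters of \<open>L\<close>. The involution \<open>g P = {a. \<sim> a \<notin> P}\<close> acts on them,
  and by the Kleene inequality \<open>P\<close> and \<open>g P\<close> are always comparable; the classes of \<open>E\<close> are the
  sets \<open>{P, g P}\<close>. The embedding sends \<open>x\<close> to the rough set of \<open>{P. x \<in> P}\<close>, whose approximations
  consist of the \<open>P\<close> with \<open>x \<in> P \<inter> g P\<close> and \<open>x \<in> P \<union> g P\<close>. Since \<open>P \<inter> g P\<close> and \<open>P \<union> g P\<close> are
  again prime filters, joins, meets and \<open>\<sim>\<close> are preserved. For the pseudocomplement, regularity
  gives \<open>\<sim> y \<sqsubseteq> y\<close> for every dense \<open>y\<close>; hence \<open>P \<union> g P\<close>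
  contains all dense elements \<open>x \<squnion> x\<star>\<close>, and the Stone identity brings \<open>x\<star>\<close> down to \<open>P \<inter> g P\<close>.
  As the images of \<open>x\<star>\<close> and \<open>(\<sim> x)\<star>\<close> are exact, regularity also yields injectivity.
\<close>

section \<open>Prime filters of a bounded distributive lattice\<close>

context bounded_distributive_lattice
begin

section \<open>Order facts derived from the lattice equations\<close>

lemma meet_idem: "x \<in> carrier L \<Longrightarrow> x \<sqinter> x = x"
  by (metis join_absorb meet_absorb meet_closed)

lemma le_iff_join:
  assumes "x \<in> carrier L" "y \<in> carrier L"
  shows "x \<sqsubseteq> y \<longleftrightarrow> x \<squnion> y = y"
  unfolding ple_def using assms by (metis join_absorb join_comm meet_absorb meet_comm)

lemma le_antisym:
  "\<lbrakk>x \<sqsubseteq> y; y \<sqsubseteq> x; x \<in> carrier L; y \<in> carrier L\<rbrakk> \<Longrightarrow> x = y"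
  unfolding ple_def by (metis meet_comm)

lemma le_trans:
  "\<lbrakk>x \<sqsubseteq> y; y \<sqsubseteq> z; x \<in> carrier L; y \<in> carrier L; z \<in> carrier L\<rbrakk> \<Longrightarrow> x \<sqsubseteq> z"
  unfolding ple_def by (metis meet_assoc)

lemma meet_lower1: "\<lbrakk>x \<in> carrier L; y \<in> carrier L\<rbrakk> \<Longrightarrow> x \<sqinter> y \<sqsubseteq> x"
  unfolding ple_def by (metis meet_assoc meet_comm meet_idem)

lemma meet_lower2: "\<lbrakk>x \<in> carrier L; y \<in> carrier L\<rbrakk> \<Longrightarrow> x \<sqinter> y \<sqsubseteq> y"
  by (metis meet_comm meet_lower1)

lemma meet_greatest:
  "\<lbrakk>z \<sqsubseteq> x; z \<sqsubseteq> y; x \<in> carrier L; y \<in> carrier L; z \<in> carrier L\<rbrakk> \<Longrightarrow> z \<sqsubseteq> x \<sqinter> y"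
  unfolding ple_def by (metis meet_assoc)

text \<open>Lets two witnesses for membership in an extended filter be replaced by their
  meet.\<close>

lemma meet_le_mono_left:
  assumes "f \<sqinter> a \<sqsubseteq> y" "g \<sqsubseteq> f"
    and L: "f \<in> carrier L" "g \<in> carrier L" "a \<in> carrier L" "y \<in> carrier L"
  shows "g \<sqinter> a \<sqsubseteq> y"
proof -
  have "g \<sqinter> a \<sqsubseteq> f"
    using le_trans[OF meet_lower1 \<open>g \<sqsubseteq> f\<close>] L by (simp add: meet_closed)
  then have "g \<sqinter> a \<sqsubseteq> f \<sqinter> a"
    using L by (intro meet_greatest) (simp_all add: meet_closed meet_lower2)
  then show ?thesis
    using le_trans[OF _ assms(1)] L by (simp add: meet_closed)
qed

lemma join_upper1: "\<lbrakk>x \<in> carrier L; y \<in> carrier L\<rbrakk> \<Longrightarrow> x \<sqsubseteq> x \<squnion> y"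
  unfolding ple_def by (rule meet_absorb)

lemma join_upper2: "\<lbrakk>x \<in> carrier L; y \<in> carrier L\<rbrakk> \<Longrightarrow> y \<sqsubseteq> x \<squnion> y"
  by (metis join_comm join_upper1)

lemma join_least:
  "\<lbrakk>x \<sqsubseteq> z; y \<sqsubseteq> z; x \<in> carrier L; y \<in> carrier L; z \<in> carrier L\<rbrakk> \<Longrightarrow> x \<squnion> y \<sqsubseteq> z"
  by (simp add: le_iff_join join_closed join_assoc)

lemma le_bot_iff: "x \<in> carrier L \<Longrightarrow> x \<sqsubseteq> \<zero> \<longleftrightarrow> x = \<zero>"
  using bot_closed bot_least le_antisym meet_idem unfolding ple_def by metis

text \<open>The equivalence encodes closure under meets and upward closure at once:
  \<open>a \<sqsubseteq> b\<close> means that \<open>a \<sqinter> b\<close> is \<open>a\<close>.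
  Improper filters are allowed.\<close>

definition lattice_filter :: "'a set \<Rightarrow> bool"
  where "lattice_filter F \<longleftrightarrow> F \<subseteq> carrier L \<and> \<one> \<in> F \<and>
    (\<forall>a\<in>carrier L. \<forall>b\<in>carrier L. a \<sqinter> b \<in> F \<longleftrightarrow> a \<in> F \<and> b \<in> F)"

text \<open>With equivalences for both operations, these are the preimages of 1 under bounded
  lattice homomorphisms to the two-element chain.\<close>

definition prime_filter :: "'a set \<Rightarrow> bool"
  where "prime_filter F \<longleftrightarrow> lattice_filter F \<and> \<zero> \<notin> F \<and>
    (\<forall>a\<in>carrier L. \<forall>b\<in>carrier L. a \<squnion> b \<in> F \<longleftrightarrow> a \<in> F \<or> b \<in> F)"

lemma lattice_filter_upward:
  "\<lbrakk>lattice_filter F; a \<in> F; a \<sqsubseteq> b; b \<in> carrier L\<rbrakk> \<Longrightarrow> b \<in> F"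
  unfolding lattice_filter_def ple_def by fastforce

lemma prime_filterD:
  assumes "prime_filter F"
  shows "F \<subseteq> carrier L" "lattice_filter F" "\<one> \<in> F" "\<zero> \<notin> F"
    "\<lbrakk>a \<in> carrier L; b \<in> carrier L\<rbrakk> \<Longrightarrow> a \<sqinter> b \<in> F \<longleftrightarrow> a \<in> F \<and> b \<in> F"
    "\<lbrakk>a \<in> carrier L; b \<in> carrier L\<rbrakk> \<Longrightarrow> a \<squnion> b \<in> F \<longleftrightarrow> a \<in> F \<or> b \<in> F"
  using assms unfolding prime_filter_def lattice_filter_def by auto

text \<open>This is the filter generated by \<open>F\<close> and \<open>a\<close>. If
  \<open>f\<close> and \<open>f'\<close> witness that \<open>b\<close> and \<open>c\<close> belong
  to it, then \<open>f \<sqinter> f'\<close> witnesses this for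
  \<open>b \<sqinter> c\<close>.\<close>

lemma lattice_filter_extend:
  assumes F: "lattice_filter F" and a: "a \<in> carrier L"
  shows "lattice_filter {b \<in> carrier L. \<exists>f\<in>F. f \<sqinter> a \<sqsubseteq> b}" (is "lattice_filter ?G")
  unfolding lattice_filter_def
proof (intro conjI ballI)
  have FL: "F \<subseteq> carrier L" using F by (simp add: lattice_filter_def)
  show "?G \<subseteq> carrier L" by blast
  show "\<one> \<in> ?G"
    using F FL a by (auto simp: lattice_filter_def top_closed intro!: bexI[of _ \<one>] top_greatest meet_closed)
  fix b c assume b: "b \<in> carrier L" and c: "c \<in> carrier L"
  show "b \<sqinter> c \<in> ?G \<longleftrightarrow> b \<in> ?G \<and> c \<in> ?G"
  proof
    assume "b \<sqinter> c \<in> ?G"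
    then obtain f where f: "f \<in> F" "f \<sqinter> a \<sqsubseteq> b \<sqinter> c" by blast
    have fL: "f \<in> carrier L" using f FL by blast
    have "f \<sqinter> a \<sqsubseteq> b" "f \<sqinter> a \<sqsubseteq> c"
      using le_trans[OF f(2)] meet_lower1[OF b c] meet_lower2[OF b c] a b c fL
      by (simp_all add: meet_closed)
    then show "b \<in> ?G \<and> c \<in> ?G" using b c f by blast
  next
    assume "b \<in> ?G \<and> c \<in> ?G"
    then obtain f f' where f: "f \<in> F" "f \<sqinter> a \<sqsubseteq> b" "f' \<in> F" "f' \<sqinter> a \<sqsubseteq> c" by blast
    have fL: "f \<in> carrier L" "f' \<in> carrier L" using f FL by auto
    let ?m = "(f \<sqinter> f') \<sqinter> a"
    have "?m \<sqsubseteq> b" "?m \<sqsubseteq> c"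
      using meet_le_mono_left[OF f(2) meet_lower1] meet_le_mono_left[OF f(4) meet_lower2] a b c fL
      by (simp_all add: meet_closed)
    then have "?m \<sqsubseteq> b \<sqinter> c"
      using a b c fL by (intro meet_greatest) (simp_all add: meet_closed)
    moreover have "f \<sqinter> f' \<in> F" using F f fL by (simp add: lattice_filter_def)
    ultimately show "b \<sqinter> c \<in> ?G" using b c by (auto simp: meet_closed)
  qed
qed

text \<open>If \<open>a\<close> and \<open>b\<close> are outside \<open>F\<close>, maximality forces
  \<open>y\<close> into the filter generated by \<open>F\<close> and \<open>a\<close>, and likewise
  for \<open>b\<close>. By distributivity a common witness then puts \<open>y\<close> above
  \<open>?m \<sqinter> (a \<squnion> b)\<close>, so \<open>a \<squnion> b\<close> is outside
  \<open>F\<close> as well.\<close>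

lemma maximal_avoiding_filter_prime:
  assumes F: "lattice_filter F" and y: "y \<in> carrier L" "y \<notin> F"
    and max: "\<And>G. \<lbrakk>lattice_filter G; y \<notin> G; F \<subseteq> G\<rbrakk> \<Longrightarrow> G = F"
  shows "prime_filter F"
  unfolding prime_filter_def
proof (intro conjI ballI)
  show "lattice_filter F" by (rule F)
  have FL: "F \<subseteq> carrier L" using F by (simp add: lattice_filter_def)
  show "\<zero> \<notin> F" using lattice_filter_upward[OF F _ bot_least[OF y(1)] y(1)] y(2) by auto
  have reach: "\<exists>f\<in>F. f \<sqinter> a \<sqsubseteq> y" if a: "a \<in> carrier L" "a \<notin> F" for a
  proof (rule ccontr)
    let ?G = "{b \<in> carrier L. \<exists>f\<in>F. f \<sqinter> a \<sqsubseteq> b}"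
    assume "\<not> ?thesis"
    then have "y \<notin> ?G" by blast
    moreover have "F \<subseteq> ?G" using FL a meet_lower1 by blast
    ultimately have "?G = F" using max lattice_filter_extend[OF F a(1)] by blast
    moreover have "a \<in> ?G"
      using F a meet_lower2[OF top_closed a(1)] by (auto simp: lattice_filter_def)
    ultimately show False using a by blast
  qed
  fix a b assume a: "a \<in> carrier L" and b: "b \<in> carrier L"
  show "a \<squnion> b \<in> F \<longleftrightarrow> a \<in> F \<or> b \<in> F"
  proof
    assume ab: "a \<squnion> b \<in> F"
    show "a \<in> F \<or> b \<in> F"
    proof (rule ccontr)
      assume "\<not> ?thesis"
      then obtain f f' where f: "f \<in> F" "f \<sqinter> a \<sqsubseteq> y" "f' \<in> F" "f' \<sqinter> b \<sqsubseteq> y"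
        using reach a b by meson
      have fL: "f \<in> carrier L" "f' \<in> carrier L" using f FL by auto
      let ?m = "f \<sqinter> f'"
      have "?m \<sqinter> a \<sqsubseteq> y" "?m \<sqinter> b \<sqsubseteq> y"
        using meet_le_mono_left[OF f(2) meet_lower1] meet_le_mono_left[OF f(4) meet_lower2] a b y fL
        by (simp_all add: meet_closed)
      then have "?m \<sqinter> (a \<squnion> b) \<sqsubseteq> y"
        using a b y fL by (simp add: meet_join_distrib meet_closed join_least)
      moreover have "?m \<sqinter> (a \<squnion> b) \<in> F"
        using F ab f fL a b by (simp add: lattice_filter_def meet_closed join_closed)
      ultimately show False using lattice_filter_upward[OF F _ _ y(1)] y(2) by auto
    qed
  next
    assume "a \<in> F \<or> b \<in> F"
    then show "a \<squnion> b \<in> F"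
      using lattice_filter_upward[OF F _ join_upper1[OF a b]]
        lattice_filter_upward[OF F _ join_upper2[OF a b]] join_closed[OF a b] by auto
  qed
qed

text \<open>Zorn's lemma gives a filter that is maximal among those containing \<open>x\<close> and
  avoiding \<open>y\<close>.\<close>

theorem prime_filter_separation:
  assumes x: "x \<in> carrier L" and y: "y \<in> carrier L" and nle: "\<not> x \<sqsubseteq> y"
  obtains P where "prime_filter P" "x \<in> P" "y \<notin> P"
proof -
  let ?A = "{F. lattice_filter F \<and> x \<in> F \<and> y \<notin> F}"
  \<comment> \<open>The principal filter of \<open>x\<close>, written as the extension of the filter
    \<open>{\<one>}\<close> by \<open>x\<close>.\<close>
  have princ: "{b \<in> carrier L. \<exists>f\<in>{\<one>}. f \<sqinter> x \<sqsubseteq> b} \<in> ?A" (is "?F \<in> _")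
  proof -
    have one: "lattice_filter {\<one>}"
    proof -
      have "a = \<one> \<and> b = \<one>" if "a \<in> carrier L" "b \<in> carrier L" "a \<sqinter> b = \<one>" for a b
      proof -
        have "\<one> \<sqsubseteq> a" "\<one> \<sqsubseteq> b"
          using meet_lower1[OF that(1,2)] meet_lower2[OF that(1,2)] that(3) by simp_all
        then show ?thesis
          using le_antisym[OF top_greatest _ _ top_closed] that(1,2) by blast
      qed
      then show ?thesis
        unfolding lattice_filter_def using top_closed meet_idem[OF top_closed] by fast
    qed
    have "\<one> \<sqinter> x = x" using top_greatest[OF x] meet_comm[OF top_closed x] by (simp add: ple_def)
    then show ?thesis
      using lattice_filter_extend[OF one x] x nle by (simp add: ple_def meet_idem)
  qed
  have "\<exists>F\<in>?A. \<forall>G\<in>?A. F \<subseteq> G \<longrightarrow> G = F"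
  proof (rule subset_Zorn_nonempty)
    from princ show "?A \<noteq> {}" by (metis empty_iff)
    fix C assume C: "C \<noteq> {}" "subset.chain ?A C"
    have CA: "\<And>F. F \<in> C \<Longrightarrow> lattice_filter F \<and> x \<in> F \<and> y \<notin> F"
      and dir: "\<And>F G. \<lbrakk>F \<in> C; G \<in> C\<rbrakk> \<Longrightarrow> F \<subseteq> G \<or> G \<subseteq> F"
      using C(2) by (auto simp: subset_chain_def)
    have "lattice_filter (\<Union>C)"
      unfolding lattice_filter_def
    proof (intro conjI ballI)
      show "\<Union>C \<subseteq> carrier L" using CA by (auto simp: lattice_filter_def)
      show "\<one> \<in> \<Union>C" using CA C(1) by (auto simp: lattice_filter_def)
      fix a b assume ab: "a \<in> carrier L" "b \<in> carrier L"
      then have iff: "\<And>F. F \<in> C \<Longrightarrow> a \<sqinter> b \<in> F \<longleftrightarrow> a \<in> F \<and> b \<in> F"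
        using CA by (simp add: lattice_filter_def)
      show "a \<sqinter> b \<in> \<Union>C \<longleftrightarrow> a \<in> \<Union>C \<and> b \<in> \<Union>C"
      proof
        assume "a \<in> \<Union>C \<and> b \<in> \<Union>C"
        then obtain F G where FG: "F \<in> C" "a \<in> F" "G \<in> C" "b \<in> G" by blast
        \<comment> \<open>The larger of the two comparable filters contains both \<open>a\<close>
          and \<open>b\<close>.\<close>
        from dir[OF FG(1,3)] show "a \<sqinter> b \<in> \<Union>C"
          using iff[OF FG(1)] iff[OF FG(3)] FG by auto
      qed (use iff in auto)
    qed
    then show "\<Union>C \<in> ?A" using CA C(1) by auto
  qed
  then obtain F where F: "lattice_filter F" "x \<in> F" "y \<notin> F"
    "\<And>G. \<lbrakk>lattice_filter G; x \<in> G; y \<notin> G; F \<subseteq> G\<rbrakk> \<Longrightarrow> G = F" by auto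
  have "prime_filter F"
  proof (rule maximal_avoiding_filter_prime)
    show "lattice_filter F" "y \<in> carrier L" "y \<notin> F" using F y by auto
    \<comment> \<open>A filter above \<open>F\<close> contains \<open>x\<close>, so maximality in
      \<open>?A\<close> is maximality among all filters avoiding \<open>y\<close>.\<close>
    fix G assume "lattice_filter G" "y \<notin> G" "F \<subseteq> G"
    then show "G = F" using F(2,4) by (simp add: subsetD)
  qed
  then show thesis using that F by blast
qed

lemma prime_filters_determine:
  assumes x: "x \<in> carrier L" and y: "y \<in> carrier L"
    and eq: "\<And>P. prime_filter P \<Longrightarrow> x \<in> P \<longleftrightarrow> y \<in> P"
  shows "x = y"
proof (rule le_antisym)
  show "x \<sqsubseteq> y" by (rule ccontr, erule prime_filter_separation[OF x y]) (use eq in auto)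
  show "y \<sqsubseteq> x" by (rule ccontr, erule prime_filter_separation[OF y x]) (use eq in auto)
qed (use x y in auto)

end

section \<open>The involution on prime filters\<close>

context pseudocomplemented_Kleene_algebra
begin

text \<open>An antitone involution exchanges joins and meets. The second inequality comes from
  bounding \<open>x \<squnion> y\<close> by \<open>\<sim> ?z\<close> and negating.\<close>

lemma neg_join:
  assumes x: "x \<in> carrier L" and y: "y \<in> carrier L"
  shows "\<sim> (x \<squnion> y) = \<sim> x \<sqinter> \<sim> y"
proof (rule le_antisym)
  let ?z = "\<sim> x \<sqinter> \<sim> y"
  have z: "?z \<in> carrier L" using x y by (simp add: neg_closed meet_closed)
  show "\<sim> (x \<squnion> y) \<sqsubseteq> ?z"
    using x y by (intro meet_greatest neg_antimono join_upper1 join_upper2 neg_closed join_closed)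
  have "\<sim> (\<sim> x) \<sqsubseteq> \<sim> ?z" "\<sim> (\<sim> y) \<sqsubseteq> \<sim> ?z"
    using x y z by (auto intro!: neg_antimono meet_lower1 meet_lower2 neg_closed)
  then have "x \<squnion> y \<sqsubseteq> \<sim> ?z"
    using x y z by (simp add: neg_neg join_least neg_closed)
  then have "\<sim> (\<sim> ?z) \<sqsubseteq> \<sim> (x \<squnion> y)"
    using x y z by (intro neg_antimono neg_closed join_closed)
  then show "?z \<sqsubseteq> \<sim> (x \<squnion> y)" using z by (simp add: neg_neg)
qed (use x y in \<open>auto simp: neg_closed meet_closed join_closed\<close>)

lemma neg_meet:
  assumes x: "x \<in> carrier L" and y: "y \<in> carrier L"
  shows "\<sim> (x \<sqinter> y) = \<sim> x \<squnion> \<sim> y"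
proof -
  have "x \<sqinter> y = \<sim> (\<sim> x \<squnion> \<sim> y)" using x y by (simp add: neg_join neg_closed neg_neg)
  then show ?thesis using x y by (simp add: neg_neg neg_closed join_closed)
qed

lemma neg_top: "\<sim> \<one> = \<zero>"
proof -
  have "\<sim> \<one> \<sqsubseteq> \<sim> (\<sim> \<zero>)"
    by (intro neg_antimono top_greatest neg_closed bot_closed top_closed)
  then show ?thesis by (simp add: neg_neg bot_closed le_bot_iff neg_closed top_closed)
qed

lemma neg_bot: "\<sim> \<zero> = \<one>"
  using neg_neg[OF top_closed] by (simp add: neg_top)

lemma meet_star: "x \<in> carrier L \<Longrightarrow> x \<sqinter> x\<star> = \<zero>"
  by (simp add: pseudocomplement star_closed ple_def meet_idem)

text \<open>The map called \<open>g\<close> in the overview, known as the Bialynicki-Birula--Rasiowa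
  involution.\<close>

definition involute :: "'a set \<Rightarrow> 'a set"
  where "involute P = {a \<in> carrier L. \<sim> a \<notin> P}"

lemma involute_iff: "a \<in> carrier L \<Longrightarrow> a \<in> involute P \<longleftrightarrow> \<sim> a \<notin> P"
  by (simp add: involute_def)

lemma involute_involute: "P \<subseteq> carrier L \<Longrightarrow> involute (involute P) = P"
  by (auto simp: involute_def neg_closed neg_neg)

text \<open>Negation exchanges meets and joins, and non-membership exchanges them back.\<close>

lemma prime_filter_involute:
  assumes "prime_filter P"
  shows "prime_filter (involute P)"
  unfolding prime_filter_def lattice_filter_def
  using prime_filterD[OF assms]
  by (auto simp: involute_def top_closed bot_closed neg_top neg_bot meet_closed join_closed
      neg_meet neg_join neg_closed)

text \<open>If neither inclusion held, there would be an \<open>a\<close> with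
  \<open>a \<sqinter> \<sim> a\<close> in \<open>P\<close> and a \<open>b\<close> with
  \<open>b \<squnion> \<sim> b\<close> outside \<open>P\<close>, against the Kleene
  inequality.\<close>

lemma involute_comparable:
  assumes P: "prime_filter P"
  shows "P \<subseteq> involute P \<or> involute P \<subseteq> P"
proof (rule ccontr)
  assume "\<not> ?thesis"
  then obtain a b where a: "a \<in> P" "a \<notin> involute P" and b: "b \<in> involute P" "b \<notin> P" by blast
  have L: "a \<in> carrier L" "b \<in> carrier L"
    using a b prime_filterD(1)[OF P] by (auto simp: involute_def)
  then have "a \<sqinter> \<sim> a \<in> P" "b \<squnion> \<sim> b \<notin> P"
    using a b by (auto simp: prime_filterD[OF P] neg_closed involute_iff)
  then show False
    using lattice_filter_upward[OF prime_filterD(2)[OF P]] Kleene[OF L] L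
    by (simp add: join_closed neg_closed)
qed

text \<open>By comparability the intersection and the union are just the smaller and the larger of
  the two prime filters.\<close>

lemma involute_union_inter:
  assumes "prime_filter P"
  shows "prime_filter (P \<inter> involute P)" "prime_filter (P \<union> involute P)"
  using involute_comparable[OF assms] assms prime_filter_involute[OF assms]
  by (auto simp: Int_absorb1 Int_absorb2 Un_absorb1 Un_absorb2)

end

section \<open>Dense elements and the pseudocomplement on prime filters\<close>

context regular_pseudocomplemented_Kleene_algebra
begin

text \<open>Regularity identifies \<open>y\<close> with \<open>y \<squnion> \<sim> y\<close>: the
  two have equal pseudocomplements, and so do their negations.\<close>

lemma dense_neg_le:
  assumes y: "y \<in> carrier L" and dense: "y\<star> = \<zero>"
  shows "\<sim> y \<sqsubseteq> y"
proof -
  have ny: "\<sim> y \<in> carrier L" using y by (rule neg_closed)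
  let ?u = "y \<squnion> \<sim> y" and ?v = "\<sim> y \<sqinter> y"
  have u: "?u \<in> carrier L" and v: "?v \<in> carrier L" using y ny join_closed meet_closed by auto
  have "?u\<star> \<sqsubseteq> y\<star>"
  proof -
    have "y \<sqinter> ?u\<star> = (y \<sqinter> ?u) \<sqinter> ?u\<star>" using y ny by (simp add: meet_absorb)
    also have "\<dots> = y \<sqinter> \<zero>" using y u by (simp add: meet_assoc star_closed meet_star)
    also have "\<dots> = \<zero>" using y by (metis bot_closed bot_least meet_comm ple_def)
    finally show ?thesis using pseudocomplement[OF y star_closed[OF u]] by simp
  qed
  then have 1: "?u\<star> = y\<star>" using u by (simp add: dense le_bot_iff star_closed)
  \<comment> \<open>Density cancels the factor \<open>y\<close>: an element disjoint from
    \<open>\<sim> y \<sqinter> y\<close> has its meet with \<open>\<sim> y\<close> below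
    \<open>y\<star>\<close>, which is \<open>\<zero>\<close>.\<close>
  have 2: "?v\<star> = (\<sim> y)\<star>"
  proof (rule le_antisym)
    let ?s = "?v\<star>"
    have s: "?s \<in> carrier L" using v by (rule star_closed)
    have "y \<sqinter> (\<sim> y \<sqinter> ?s) = ?v \<sqinter> ?s"
      using y ny s by (metis meet_assoc meet_comm)
    then have "\<sim> y \<sqinter> ?s \<sqsubseteq> y\<star>"
      using pseudocomplement[OF y meet_closed[OF ny s]] meet_star[OF v] by simp
    then show "?s \<sqsubseteq> (\<sim> y)\<star>"
      using pseudocomplement[OF ny s] by (simp add: dense le_bot_iff ny s meet_closed)
    have t: "(\<sim> y)\<star> \<in> carrier L" using ny by (rule star_closed)
    have "?v \<sqinter> (\<sim> y)\<star> = y \<sqinter> (\<sim> y \<sqinter> (\<sim> y)\<star>)"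
      using y ny t by (metis meet_assoc meet_comm)
    also have "\<dots> = \<zero>" using y ny by (metis bot_closed bot_least meet_comm ple_def meet_star)
    finally show "(\<sim> y)\<star> \<sqsubseteq> ?s" using pseudocomplement[OF v t] by simp
  qed (use ny v in \<open>auto intro: star_closed\<close>)
  have "\<sim> ?u = ?v" using y ny by (simp add: neg_join neg_neg)
  then have "?u = y" using regular[OF u y] 1 2 by simp
  then show ?thesis using join_upper2[OF y ny] by simp
qed

text \<open>The union contains \<open>z\<close> or \<open>\<sim> z\<close> for every
  \<open>z\<close> in the carrier. For the dense element \<open>x \<squnion> x\<star>\<close> this
  means it contains the element itself, hence \<open>x\<close> or \<open>x\<star>\<close>; it cannot
  contain both, since their meet is \<open>\<zero>\<close>.\<close>

lemma star_mem_involute_union: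
  assumes P: "prime_filter P" and x: "x \<in> carrier L"
  shows "x\<star> \<in> P \<union> involute P \<longleftrightarrow> x \<notin> P \<union> involute P"
proof -
  let ?M = "P \<union> involute P"
  have M: "prime_filter ?M" using involute_union_inter[OF P] by simp
  have xs: "x\<star> \<in> carrier L" using x by (rule star_closed)
  let ?y = "x \<squnion> x\<star>"
  have y: "?y \<in> carrier L" using x xs by (rule join_closed)
  have ys: "?y\<star> \<in> carrier L" using y by (rule star_closed)
  \<comment> \<open>Density of \<open>?y\<close>: its pseudocomplement is disjoint from
    \<open>x\<close>, so it lies below \<open>x\<star>\<close>, from which it is disjoint
    too.\<close>
  have "?y\<star> \<sqinter> x \<sqsubseteq> \<zero>" "?y\<star> \<sqinter> x\<star> \<sqsubseteq> \<zero>"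
  proof -
    have "?y\<star> \<sqinter> ?y = \<zero>" using meet_star[OF y] meet_comm[OF y ys] by simp
    then have "(?y\<star> \<sqinter> x) \<squnion> (?y\<star> \<sqinter> x\<star>) = \<zero>" using meet_join_distrib[OF ys x xs] by simp
    then show "?y\<star> \<sqinter> x \<sqsubseteq> \<zero>" "?y\<star> \<sqinter> x\<star> \<sqsubseteq> \<zero>"
      using join_upper1 join_upper2 meet_closed ys x xs by metis+
  qed
  then have "x \<sqinter> ?y\<star> = \<zero>" "x\<star> \<sqinter> ?y\<star> = \<zero>"
    using x xs ys by (simp_all add: le_bot_iff meet_closed meet_comm)
  then have "?y\<star> = \<zero>" using pseudocomplement[OF x ys] meet_comm[OF xs ys] by (simp add: ple_def)
  then have le: "\<sim> ?y \<sqsubseteq> ?y" by (rule dense_neg_le[OF y])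
  have "?y \<in> ?M"
  proof (rule ccontr)
    assume n: "?y \<notin> ?M"
    then have "\<sim> ?y \<in> ?M" using y by (simp add: involute_iff)
    then show False using lattice_filter_upward[OF prime_filterD(2)[OF M] _ le y] n by blast
  qed
  moreover have "x \<sqinter> x\<star> \<notin> ?M" unfolding meet_star[OF x] by (rule prime_filterD(4)[OF M])
  ultimately show ?thesis using prime_filterD(5,6)[OF M x xs] by blast
qed

text \<open>The Stone identity puts \<open>x\<star>\<close> or \<open>(x\<star>)\<star>\<close> into
  the prime filter \<open>P \<inter> involute P\<close>. In the second case \<open>x\<star>\<close>
  is not even in the union, so \<open>x\<close> is.\<close>

lemma star_mem_involute_inter:
  assumes stone: "x\<star> \<squnion> (x\<star>)\<star> = \<one>" and P: "prime_filter P" and x: "x \<in> carrier L"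
  shows "x\<star> \<in> P \<inter> involute P \<longleftrightarrow> x \<notin> P \<union> involute P"
proof -
  have xs: "x\<star> \<in> carrier L" "(x\<star>)\<star> \<in> carrier L" using x by (auto intro: star_closed)
  have m: "prime_filter (P \<inter> involute P)" using involute_union_inter[OF P] by simp
  have "x\<star> \<in> P \<inter> involute P \<or> (x\<star>)\<star> \<in> P \<inter> involute P"
    using prime_filterD(3,6)[OF m] xs stone by metis
  then show ?thesis
    using star_mem_involute_union[OF P x] star_mem_involute_union[OF P xs(1)] by blast
qed

section \<open>The embedding into rough sets\<close>

abbreviation spectrum :: "'a set set"
  where "spectrum \<equiv> Collect prime_filter"

definition indisc :: "('a set \<times> 'a set) set"
  where "indisc = {(P, Q). prime_filter P \<and> (Q = P \<or> Q = involute P)}"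

definition rough_rep :: "'a \<Rightarrow> 'a set set \<times> 'a set set"
  where "rough_rep x = rough spectrum indisc {P. prime_filter P \<and> x \<in> P}"

lemma equiv_indisc: "equiv spectrum indisc"
  unfolding equiv_def refl_on_def sym_def trans_def indisc_def
  using prime_filter_involute involute_involute[OF prime_filterD(1)] by auto

text \<open>Reduces the homomorphism laws to membership in two prime filters per point.\<close>

lemma rough_rep_eq:
  "rough_rep x =
    ({P. prime_filter P \<and> x \<in> P \<inter> involute P}, {P. prime_filter P \<and> x \<in> P \<union> involute P})"
proof -
  have "indisc `` {P} = {P, involute P}" if "prime_filter P" for P
    using that by (auto simp: indisc_def)
  then show ?thesis
    unfolding rough_rep_def rough_def lower_approx_def upper_approx_def
    by (auto simp: prime_filter_involute cong: conj_cong)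
qed

lemma rough_rep_in_RS: "rough_rep x \<in> RS spectrum indisc"
  unfolding rough_rep_def RS_def by blast

lemma rough_rep_bot: "rough_rep \<zero> = ({}, {})"
  using prime_filterD(4) prime_filterD(4)[OF prime_filter_involute]
  by (auto simp: rough_rep_eq)

lemma rough_rep_top: "rough_rep \<one> = (spectrum, spectrum)"
  using prime_filterD(3) prime_filterD(3)[OF prime_filter_involute]
  by (auto simp: rough_rep_eq)

text \<open>Lower approximations need not preserve unions; here they do because
  \<open>P \<inter> involute P\<close> is prime.\<close>

lemma rough_rep_join:
  "\<lbrakk>x \<in> carrier L; y \<in> carrier L\<rbrakk> \<Longrightarrow> rough_rep (x \<squnion> y) =
    (fst (rough_rep x) \<union> fst (rough_rep y), snd (rough_rep x) \<union> snd (rough_rep y))"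
  using prime_filterD(6)[OF involute_union_inter(1)] prime_filterD(6)[OF involute_union_inter(2)]
  unfolding rough_rep_eq fst_conv snd_conv by (intro arg_cong2[of _ _ _ _ Pair]) blast+

lemma rough_rep_meet:
  "\<lbrakk>x \<in> carrier L; y \<in> carrier L\<rbrakk> \<Longrightarrow> rough_rep (x \<sqinter> y) =
    (fst (rough_rep x) \<inter> fst (rough_rep y), snd (rough_rep x) \<inter> snd (rough_rep y))"
  using prime_filterD(5)[OF involute_union_inter(1)] prime_filterD(5)[OF involute_union_inter(2)]
  unfolding rough_rep_eq fst_conv snd_conv by (intro arg_cong2[of _ _ _ _ Pair]) blast+

text \<open>Evaluates the complement of the canonical representative, through which
  \<open>rs_neg\<close> and \<open>rs_star\<close> are computed.\<close>

lemma rough_rep_compl: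
  "rough spectrum indisc (spectrum - {P. prime_filter P \<and> x \<in> P}) =
    (spectrum - snd (rough_rep x), spectrum - fst (rough_rep x))"
  by (simp add: rough_rep_def rough_def approx_compl[OF equiv_indisc])

lemma rough_rep_neg:
  assumes x: "x \<in> carrier L"
  shows "rough_rep (\<sim> x) = rs_neg spectrum indisc (rough_rep x)"
proof -
  have "rs_neg spectrum indisc (rough_rep x) =
      (spectrum - snd (rough_rep x), spectrum - fst (rough_rep x))"
    unfolding rough_rep_compl[symmetric]
    unfolding rough_rep_def by (rule rs_neg_rough[OF equiv_indisc]) blast
  \<comment> \<open>\<open>\<sim> x\<close> is in \<open>P\<close> iff \<open>x\<close> is not in
    \<open>involute P\<close>, and vice versa, so negation complements and swaps the two
    components.\<close>
  then show ?thesis using x by (auto simp: rough_rep_eq involute_iff neg_closed neg_neg)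
qed

lemma rough_rep_star:
  assumes stone: "x\<star> \<squnion> (x\<star>)\<star> = \<one>" and x: "x \<in> carrier L"
  shows "rough_rep (x\<star>) = (spectrum - snd (rough_rep x), spectrum - snd (rough_rep x))"
  using star_mem_involute_inter[OF stone _ x] star_mem_involute_union[OF _ x]
  unfolding rough_rep_eq fst_conv snd_conv by (intro arg_cong2[of _ _ _ _ Pair]) auto

lemma rs_star_rough_rep:
  "rs_star spectrum indisc (rough_rep x) =
    (spectrum - snd (rough_rep x), spectrum - snd (rough_rep x))"
proof -
  have "rs_star spectrum indisc (rough_rep x) =
      (fst (rough spectrum indisc (spectrum - {P. prime_filter P \<and> x \<in> P})),
       fst (rough spectrum indisc (spectrum - {P. prime_filter P \<and> x \<in> P})))"
    unfolding rough_rep_def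
    by (subst rs_star_rough[OF equiv_indisc]) (auto simp: rough_def)
  then show ?thesis by (simp add: rough_rep_compl)
qed

text \<open>The image of \<open>x\<close> determines \<open>x\<star>\<close>, and through
  \<open>rough_rep_neg\<close> also \<open>(\<sim> x)\<star>\<close>; regularity then recovers
  \<open>x\<close>.\<close>

lemma rough_rep_inj:
  assumes stone: "\<And>x. x \<in> carrier L \<Longrightarrow> x\<star> \<squnion> (x\<star>)\<star> = \<one>"
  shows "inj_on rough_rep (carrier L)"
proof (rule inj_onI)
  have star: "a\<star> = b\<star>"
    if a: "a \<in> carrier L" and b: "b \<in> carrier L" and eq: "rough_rep a = rough_rep b" for a b
  proof (rule prime_filters_determine)
    fix P assume P: "prime_filter P"
    \<comment> \<open>\<open>P\<close> lies between \<open>P \<inter> involute P\<close> and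
      \<open>P \<union> involute P\<close>, which agree on containing
      \<open>c\<star>\<close>.\<close>
    have iff: "c\<star> \<in> P \<longleftrightarrow> P \<notin> snd (rough_rep c)" if "c \<in> carrier L" for c
      using star_mem_involute_inter[OF stone P] star_mem_involute_union[OF P] that P
      by (auto simp: rough_rep_eq)
    show "a\<star> \<in> P \<longleftrightarrow> b\<star> \<in> P" using iff a b eq by simp
  qed (use a b in \<open>auto intro: star_closed\<close>)
  fix x y assume x: "x \<in> carrier L" and y: "y \<in> carrier L" and eq: "rough_rep x = rough_rep y"
  have "rough_rep (\<sim> x) = rough_rep (\<sim> y)" using eq x y by (simp add: rough_rep_neg)
  then show "x = y"
    by (intro regular[OF x y] star[OF x y eq] star neg_closed x y)
qed

end

theorem theorem4p6:
  fixes L :: "('a, 'm) pk_algebra_scheme" (structure)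
  assumes "regular_pseudocomplemented_Kleene_algebra L"
    and "\<And>x. x \<in> carrier L \<Longrightarrow> x\<star> \<squnion> (x\<star>)\<star> = \<one>"
  shows "\<exists>(U :: 'a set set) (E :: ('a set \<times> 'a set) set) S.
    equiv U E \<and> pk_subalgebra S (RS_algebra U E) \<and>
    pk_isomorphic L ((RS_algebra U E)\<lparr>carrier := S\<rparr>)"
proof -
  interpret regular_pseudocomplemented_Kleene_algebra L by (rule assms(1))
  let ?A = "RS_algebra spectrum indisc" and ?S = "rough_rep ` carrier L"
  have hom: "rough_rep \<zero> = \<zero>\<^bsub>?A\<^esub>" "rough_rep \<one> = \<one>\<^bsub>?A\<^esub>"
    "\<And>x y. \<lbrakk>x \<in> carrier L; y \<in> carrier L\<rbrakk> \<Longrightarrow>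
      rough_rep (x \<squnion> y) = rough_rep x \<squnion>\<^bsub>?A\<^esub> rough_rep y"
    "\<And>x y. \<lbrakk>x \<in> carrier L; y \<in> carrier L\<rbrakk> \<Longrightarrow>
      rough_rep (x \<sqinter> y) = rough_rep x \<sqinter>\<^bsub>?A\<^esub> rough_rep y"
    "\<And>x. x \<in> carrier L \<Longrightarrow> rough_rep (\<sim> x) = \<sim>\<^bsub>?A\<^esub> rough_rep x"
    "\<And>x. x \<in> carrier L \<Longrightarrow> rough_rep (x\<star>) = (rough_rep x)\<star>\<^bsub>?A\<^esub>"
    by (simp_all add: RS_algebra_def rough_rep_bot rough_rep_top rough_rep_join rough_rep_meet
        rough_rep_neg rough_rep_star[OF assms(2)] rs_star_rough_rep)
  have "?S \<subseteq> carrier ?A" using rough_rep_in_RS by (auto simp: RS_algebra_def)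
  then have "pk_subalgebra ?S ?A"
    unfolding pk_subalgebra_def ball_simps
    \<comment> \<open>Read backwards, the homomorphism equations turn operations on images into
      images, which gives closure.\<close>
    by (auto simp flip: hom intro!: imageI bot_closed top_closed join_closed meet_closed
        neg_closed star_closed)
  moreover have "rough_rep \<in> pk_iso L (?A\<lparr>carrier := ?S\<rparr>)"
    using hom rough_rep_inj[OF assms(2)] by (simp add: pk_iso_def bij_betw_def)
  then have "pk_isomorphic L (?A\<lparr>carrier := ?S\<rparr>)"
    unfolding pk_isomorphic_def by blast
  ultimately show ?thesis using equiv_indisc by blast
qed

end
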